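(* Let $\mathcal H$ be a complex Hilbert space, $m\in\mathbb N$, and let $T\in B(\mathcal H)$ be an $m$-isometry. Suppose that $T^l$ is compact for some $l\in\mathbb N$. Then $\dim\mathcal H<\infty$ and $T$ is an algebraic $m$-isometry.
   Context: $\mathbb N$ is the set of positive integers; $B(\mathcal H)$ is the algebra of bounded linear operators on $\mathcal H$. $T\in B(\mathcal H)$ is an $m$-isometry if $\sum_{k=0}^m(-1)^k\binom mk T^{*k}T^k=0$. $T$ is algebraic if $p(T)=0$ for some nonzero polynomial $p\in\mathbb C[x]$. *)

theory Defs
  imports "HOL-Analysis.Analysis" "HOL-Computational_Algebra.Polynomial"
begin

text \<open>Complex inner product spaces sit on top of the real normed spaces of the library: the
  complex scalar multiplication extends the real one, and the inner product (linear in the first,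
  conjugate-linear in the second argument) induces the given norm, hence also the metric and the
  topology.\<close>

class complex_inner = real_normed_vector +
  fixes scaleC :: "complex \<Rightarrow> 'a \<Rightarrow> 'a"  (infixr \<open>*\<^sub>C\<close> 75)
    and cinner :: "'a \<Rightarrow> 'a \<Rightarrow> complex"
  assumes scaleC_add_right: "a *\<^sub>C (x + y) = a *\<^sub>C x + a *\<^sub>C y"
    and scaleC_add_left: "(a + b) *\<^sub>C x = a *\<^sub>C x + b *\<^sub>C x"
    and scaleC_scaleC: "a *\<^sub>C (b *\<^sub>C x) = (a * b) *\<^sub>C x"
    and scaleC_of_real: "complex_of_real r *\<^sub>C x = scaleR r x"
    and cinner_commute: "cinner x y = cnj (cinner y x)"
    and cinner_add_left: "cinner (x + y) z = cinner x z + cinner y z"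
    and cinner_scaleC_left: "cinner (a *\<^sub>C x) y = a * cinner x y"
    and cinner_self: "cinner x x = complex_of_real ((norm x)\<^sup>2)"

class chilbert_space = complex_inner + complete_space

instantiation complex :: chilbert_space
begin

definition scaleC_complex :: "complex \<Rightarrow> complex \<Rightarrow> complex"
  where "scaleC_complex a x = a * x"

definition cinner_complex :: "complex \<Rightarrow> complex \<Rightarrow> complex"
  where "cinner_complex x y = x * cnj y"

instance
  by standard
    (simp_all add: scaleC_complex_def cinner_complex_def algebra_simps scaleR_conv_of_real
      complex_norm_square [symmetric] of_real_power [symmetric] del: of_real_power)

end

lemma vector_space_scaleC:
  "vector_space (scaleC :: complex \<Rightarrow> 'a \<Rightarrow> 'a::complex_inner)"
proof
  fix x :: 'a
  show "1 *\<^sub>C x = x"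
    using scaleC_of_real [of 1 x] by simp
qed (simp_all add: scaleC_add_right scaleC_add_left scaleC_scaleC)

definition bounded_clinear :: "('a::complex_inner \<Rightarrow> 'a) \<Rightarrow> bool"
  where "bounded_clinear T \<longleftrightarrow>
    Vector_Spaces.linear scaleC scaleC T \<and> (\<exists>K. \<forall>x. norm (T x) \<le> norm x * K)"

text \<open>For bounded operators on a Hilbert space, the adjoint exists uniquely by the Riesz
  representation theorem; on other functions the value is unspecified.\<close>

definition cadjoint :: "('a::chilbert_space \<Rightarrow> 'a) \<Rightarrow> 'a \<Rightarrow> 'a"
  where "cadjoint T = (THE S. \<forall>x y. cinner (T x) y = cinner x (S y))"

definition m_isometry :: "nat \<Rightarrow> ('a::chilbert_space \<Rightarrow> 'a) \<Rightarrow> bool"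
  where "m_isometry m T \<longleftrightarrow> bounded_clinear T \<and>
    (\<forall>x. (\<Sum>k=0..m. ((-1) ^ k * of_nat (m choose k)) *\<^sub>C (cadjoint T ^^ k) ((T ^^ k) x)) = 0)"

definition compact_operator :: "('a::complex_inner \<Rightarrow> 'a) \<Rightarrow> bool"
  where "compact_operator T \<longleftrightarrow> bounded_clinear T \<and> compact (closure (T ` cball 0 1))"

definition poly_operator :: "complex poly \<Rightarrow> ('a::complex_inner \<Rightarrow> 'a) \<Rightarrow> 'a \<Rightarrow> 'a"
  where "poly_operator p T x = (\<Sum>i\<le>degree p. coeff p i *\<^sub>C (T ^^ i) x)"

definition algebraic_operator :: "('a::complex_inner \<Rightarrow> 'a) \<Rightarrow> bool"
  where "algebraic_operator T \<longleftrightarrow> (\<exists>p. p \<noteq> 0 \<and> (\<forall>x. poly_operator p T x = 0))"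

end

(* The m-isometry identity, paired with x, reads sum_k (-1)^k (m choose k) |T^k x|^2 = 0. Moving all
   terms but k = 0 to the other side gives |x| <= c |T x|, hence |x| <= c^l |T^l x|. Distinct
   orthonormal vectors then have images under T^l that are at distance at least sqrt 2 / c^l, so
   compactness of T^l bounds the size of orthonormal sets and H is finite-dimensional. *)

theory Submission
  imports Defs
begin

section \<open>Elementary identities for the complex inner product\<close>

interpretation complex_vector: vector_space "scaleC :: complex \<Rightarrow> 'a \<Rightarrow> 'a::complex_inner"
  by (rule vector_space_scaleC)

lemma cinner_zero_left [simp]: "cinner 0 y = 0"
  using cinner_add_left [of 0 0 y] by simp

lemma cinner_add_right: "cinner x (y + z) = cinner x y + cinner x z"
  by (metis cinner_add_left cinner_commute complex_cnj_add)

lemma cinner_scaleC_right: "cinner x (a *\<^sub>C y) = cnj a * cinner x y"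
  by (metis cinner_commute cinner_scaleC_left complex_cnj_mult)

lemma cinner_zero_right [simp]: "cinner x 0 = 0"
  using cinner_add_right [of x 0 0] by simp

lemma cinner_diff_left: "cinner (x - y) z = cinner x z - cinner y z"
  using cinner_add_left [of "x - y" y z] by (simp add: algebra_simps)

lemma cinner_diff_right: "cinner z (x - y) = cinner z x - cinner z y"
  using cinner_add_right [of z "x - y" y] by (simp add: algebra_simps)

lemma cinner_scaleR_right: "cinner x (r *\<^sub>R y) = of_real r * cinner x y"
  by (simp add: cinner_scaleC_right flip: scaleC_of_real)

lemma cinner_sum_left: "cinner (sum f A) y = (\<Sum>a\<in>A. cinner (f a) y)"
  by (induction A rule: infinite_finite_induct) (simp_all add: cinner_add_left)

lemma Re_cinner_commute: "Re (cinner y x) = Re (cinner x y)"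
  by (subst cinner_commute) simp

lemma norm_add_square:
  "(norm (x + y))\<^sup>2 = (norm x)\<^sup>2 + 2 * Re (cinner x y) + (norm y)\<^sup>2"
proof -
  have "complex_of_real ((norm (x + y))\<^sup>2) = cinner (x + y) (x + y)"
    by (simp add: cinner_self)
  also have "\<dots> = cinner x x + cinner x y + cinner y x + cinner y y"
    by (simp add: cinner_add_left cinner_add_right)
  finally have "Re (complex_of_real ((norm (x + y))\<^sup>2)) = Re \<dots>"
    by simp
  then show ?thesis
    by (simp add: cinner_self Re_cinner_commute [of y x] flip: of_real_power)
qed

lemma parallelogram:
  fixes x y :: "'a::complex_inner"
  shows "(norm (x + y))\<^sup>2 + (norm (x - y))\<^sup>2 = 2 * (norm x)\<^sup>2 + 2 * (norm y)\<^sup>2"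
  using norm_add_square [of x y] norm_add_square [of x "- y"] cinner_diff_right [of x 0 y]
  by simp

section \<open>Riesz representation of bounded functionals\<close>

lemma linear_coeff_zero:
  fixes b c :: real
  assumes "\<And>t. 0 \<le> t\<^sup>2 * c + t * b" and "0 \<le> c"
  shows "b = 0"
proof (rule ccontr)
  assume "b \<noteq> 0"
  \<comment> \<open>The quadratic would be minimal near \<open>t = - b / c\<close>. The denominator
    \<open>c + 1\<close> also covers \<open>c = 0\<close> and still makes the value negative when
    \<open>b\<close> is nonzero.\<close>
  have "0 \<le> (- b / (c + 1))\<^sup>2 * c + (- b / (c + 1)) * b"
    by (rule assms)
  also have "\<dots> = - (b / (c + 1))\<^sup>2"
    using assms(2) by (simp add: divide_simps power2_eq_square) (simp add: algebra_simps)
  finally have "(b / (c + 1))\<^sup>2 \<le> 0"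
    by simp
  then show False
    using \<open>b \<noteq> 0\<close> assms(2) by simp
qed

text \<open>The representing vector minimises \<open>(norm x)\<^sup>2 - 2 * Re (f x)\<close>; the parallelogram law makes
  every minimising sequence Cauchy.\<close>

theorem riesz_representation:
  fixes f :: "'a::chilbert_space \<Rightarrow> complex"
  assumes add: "\<And>x y. f (x + y) = f x + f y"
    and scale: "\<And>a x. f (a *\<^sub>C x) = a * f x"
    and bound: "\<And>x. norm (f x) \<le> norm x * K"
  obtains z where "\<And>x. f x = cinner x z"
proof -
  define J where "J x = (norm x)\<^sup>2 - 2 * Re (f x)" for x
  have scaleR: "f (r *\<^sub>R x) = of_real r * f x" for r x
    by (simp add: scale flip: scaleC_of_real)
  have "J x \<ge> - K\<^sup>2" for x
  proof -
    have "Re (f x) \<le> norm x * K"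
      using complex_Re_le_cmod bound order_trans by blast
    moreover have "0 \<le> (norm x - K)\<^sup>2"
      by simp
    ultimately show ?thesis
      by (simp add: J_def power2_diff)
  qed
  then have bdd: "bdd_below (range J)"
    by (auto intro!: bdd_belowI)
  define d where "d = Inf (range J)"
  have d_le: "d \<le> J x" for x
    unfolding d_def by (rule cINF_lower [OF bdd]) simp
  have "\<exists>x. J x < d + 1 / real (Suc n)" for n
    using cInf_lessD [of "range J" "d + 1 / real (Suc n)"] by (auto simp: d_def)
  then obtain X where X: "\<And>n. J (X n) < d + 1 / real (Suc n)"
    by metis
  \<comment> \<open>The midpoint also has \<open>J\<close>-value at least \<open>d\<close>, so the
    parallelogram law bounds the distance of two points by their excesses over the infimum.\<close>
  have mid: "(norm (x - y))\<^sup>2 \<le> 2 * (J x - d) + 2 * (J y - d)" for x y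
  proof -
    have "4 * J ((1/2) *\<^sub>R (x + y)) = (norm (x + y))\<^sup>2 - 4 * Re (f x) - 4 * Re (f y)"
      by (simp add: J_def scaleR add power_divide add_divide_distrib)
    moreover have "4 * d \<le> 4 * J ((1/2) *\<^sub>R (x + y))"
      using d_le by simp
    ultimately show ?thesis
      using parallelogram [of x y] unfolding J_def by argo
  qed
  have "Cauchy X"
  proof (rule metric_CauchyI)
    fix e :: real
    assume "e > 0"
    then obtain N where N: "1 / real (Suc N) < e\<^sup>2 / 4"
      using nat_approx_posE [of "e\<^sup>2 / 4"] by auto
    have close: "J (X n) - d < e\<^sup>2 / 4" if "n \<ge> N" for n
    proof -
      have "1 / real (Suc n) \<le> 1 / real (Suc N)"
        using that by (simp add: frac_le)
      then show ?thesis
        using X [of n] N by linarith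
    qed
    have "(norm (X i - X j))\<^sup>2 < e\<^sup>2" if "i \<ge> N" "j \<ge> N" for i j
    proof -
      have "2 * (J (X i) - d) + 2 * (J (X j) - d) < 2 * (e\<^sup>2 / 4) + 2 * (e\<^sup>2 / 4)"
        by (intro add_strict_mono mult_strict_left_mono close that) simp_all
      also have "\<dots> = e\<^sup>2"
        by simp
      finally show ?thesis
        using mid order.strict_trans1 by blast
    qed
    then have "norm (X i - X j) < e" if "i \<ge> N" "j \<ge> N" for i j
      using that \<open>e > 0\<close> power_less_imp_less_base [of "norm (X i - X j)" 2 e] by simp
    then show "\<exists>M. \<forall>i\<ge>M. \<forall>j\<ge>M. dist (X i) (X j) < e"
      by (auto simp: dist_norm)
  qed
  then obtain z where z: "X \<longlonglongrightarrow> z"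
    using Cauchy_convergent_iff convergent_def by blast
  have "bounded_linear f"
    by (rule bounded_linear_intro [where K = K]) (simp_all add: add scaleR bound scaleR_conv_of_real)
  then have "(\<lambda>n. f (X n)) \<longlonglongrightarrow> f z"
    using z by (rule bounded_linear.tendsto)
  then have "(\<lambda>n. J (X n)) \<longlonglongrightarrow> J z"
    unfolding J_def using z by (intro tendsto_intros)
  moreover have "(\<lambda>n. d + 1 / real (Suc n)) \<longlonglongrightarrow> d + 0"
    by (intro tendsto_intros LIMSEQ_Suc [OF lim_1_over_n])
  ultimately have "J z \<le> d + 0"
    by (rule LIMSEQ_le) (use X less_imp_le in blast)
  then have J_min: "J z \<le> J x" for x
    using d_le [of x] by simp
  have Re_eq: "Re (f x) = Re (cinner x z)" for x
  proof -
    have "2 * (Re (cinner z x) - Re (f x)) = 0"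
    \<comment> \<open>Along the line \<open>z + t *\<^sub>R x\<close> the difference
      \<open>J (z + t *\<^sub>R x) - J z\<close> is a quadratic in \<open>t\<close> without constant
      term. It is nonnegative because \<open>z\<close> is a minimiser, so its linear coefficient
      vanishes.\<close>
    proof (rule linear_coeff_zero [where c = "(norm x)\<^sup>2"])
      fix t :: real
      show "0 \<le> t\<^sup>2 * (norm x)\<^sup>2 + t * (2 * (Re (cinner z x) - Re (f x)))"
        using J_min [of "z + t *\<^sub>R x"]
        by (simp add: J_def norm_add_square add scaleR cinner_scaleR_right power_mult_distrib
            algebra_simps)
    qed simp
    then show ?thesis
      by (simp add: Re_cinner_commute [of z x])
  qed
  \<comment> \<open>\<open>J\<close> only sees real parts. Imaginary parts are recovered by complex
    linearity, since multiplying by \<open>\<i>\<close> turns the imaginary part into minus the real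
    part.\<close>
  have "f x = cinner x z" for x
    using Re_eq [of x] Re_eq [of "\<i> *\<^sub>C x"]
    by (simp add: complex_eq_iff scale cinner_scaleC_left)
  then show ?thesis
    by (rule that)
qed

section \<open>Bounded operators, the Cauchy-Schwarz inequality and the adjoint\<close>

lemma bounded_clinear_add: "bounded_clinear T \<Longrightarrow> T (x + y) = T x + T y"
  and bounded_clinear_scaleC: "bounded_clinear T \<Longrightarrow> T (a *\<^sub>C x) = a *\<^sub>C T x"
  by (auto simp: bounded_clinear_def Vector_Spaces.linear_iff)

lemma bounded_clinear_zero: "bounded_clinear T \<Longrightarrow> T 0 = 0"
  using bounded_clinear_add [of T 0 0] by simp

lemma bounded_clinear_diff: "bounded_clinear T \<Longrightarrow> T (x - y) = T x - T y"
  using bounded_clinear_add [of T "x - y" y] by (simp add: algebra_simps)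

text \<open>Cauchy-Schwarz is deduced from the triangle inequality, which the normed space already
  provides. A unimodular factor \<open>a\<close> rotates \<open>x\<close> until the inner product
  equals its own modulus; then the expansion of the squared norm of \<open>a *\<^sub>C x + y\<close>
  is compared with the square of \<open>norm x + norm y\<close>.\<close>

lemma norm_cinner_le: "norm (cinner x y) \<le> norm x * norm y"
proof (cases "cinner x y = 0")
  case False
  define a where "a = cnj (sgn (cinner x y))"
  have a: "norm a = 1"
    using False by (simp add: a_def norm_sgn)
  \<comment> \<open>The normed space axioms treat only real scalars, so invariance under a
    unimodular complex scalar comes from the inner product.\<close>
  have na: "norm (a *\<^sub>C v) = norm v" for v :: 'a
  proof -
    have "complex_of_real ((norm (a *\<^sub>C v))\<^sup>2) = cinner (a *\<^sub>C v) (a *\<^sub>C v)"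
      by (simp add: cinner_self)
    also have "\<dots> = (a * cnj a) * cinner v v"
      by (simp add: cinner_scaleC_left cinner_scaleC_right)
    also have "a * cnj a = 1"
      using a by (simp add: complex_norm_square [symmetric])
    finally have "complex_of_real ((norm (a *\<^sub>C v))\<^sup>2) = complex_of_real ((norm v)\<^sup>2)"
      by (simp only: cinner_self mult_1)
    then show ?thesis
      by (simp del: of_real_power)
  qed
  have "cinner (a *\<^sub>C x) y = complex_of_real (norm (cinner x y))"
    using False
    using complex_norm_square [of "cinner x y"]
    by (simp add: a_def cinner_scaleC_left sgn_eq divide_eq_eq power2_eq_square mult.commute)
  then have "norm (cinner x y) = Re (cinner (a *\<^sub>C x) y)"
    by simp
  also have "2 * \<dots> = (norm (a *\<^sub>C x + y))\<^sup>2 - (norm (a *\<^sub>C x))\<^sup>2 - (norm y)\<^sup>2"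
    by (simp add: norm_add_square)
  finally have "2 * norm (cinner x y) = \<dots>"
    by simp
  also have "\<dots> \<le> (norm x + norm y)\<^sup>2 - (norm x)\<^sup>2 - (norm y)\<^sup>2"
    using norm_triangle_ineq [of "a *\<^sub>C x" y] by (simp add: na power_mono)
  finally show ?thesis
    by (simp add: power2_sum)
qed simp

text \<open>As \<open>cadjoint\<close> is a definite description, its defining property needs both
  existence and uniqueness. Riesz representation of \<open>\<lambda>x. cinner (T x) y\<close>, for
  each \<open>y\<close>, gives the former; the latter follows by pairing the difference of two
  candidates with itself.\<close>

lemma cinner_cadjoint:
  fixes T :: "'a::chilbert_space \<Rightarrow> 'a"
  assumes T: "bounded_clinear T"
  shows "cinner (T x) y = cinner x (cadjoint T y)"
proof -
  obtain K where K: "\<And>x. norm (T x) \<le> norm x * K"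
    using T by (auto simp: bounded_clinear_def)
  have "\<exists>z. \<forall>x. cinner (T x) y = cinner x z" for y
  proof -
    have "norm (cinner (T x) y) \<le> norm x * (K * norm y)" for x
      using norm_cinner_le [of "T x" y] mult_right_mono [OF K [of x], of "norm y"]
      by (simp add: mult.assoc)
    then obtain z where "\<And>x. cinner (T x) y = cinner x z"
      using riesz_representation [of "\<lambda>x. cinner (T x) y" "K * norm y"]
      by (auto simp: bounded_clinear_add [OF T] bounded_clinear_scaleC [OF T] cinner_add_left
          cinner_scaleC_left)
    then show ?thesis
      by blast
  qed
  then obtain S where S: "\<And>x y. cinner (T x) y = cinner x (S y)"
    by metis
  have "S' = S" if "\<forall>x y. cinner (T x) y = cinner x (S' y)" for S'
  proof
    fix y
    have "cinner (S' y - S y) (S' y - S y) = 0"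
      using that S by (simp add: cinner_diff_right)
    then show "S' y = S y"
      by (simp add: cinner_self)
  qed
  then have "cadjoint T = S"
    unfolding cadjoint_def using S by (intro the_equality) blast+
  then show ?thesis
    using S by simp
qed

lemma cinner_funpow_cadjoint:
  assumes "bounded_clinear T"
  shows "cinner ((T ^^ k) x) y = cinner x ((cadjoint T ^^ k) y)"
  by (induction k arbitrary: x y)
    (simp_all add: cinner_cadjoint [OF assms] flip: funpow_swap1)

section \<open>Lower bounds for m-isometries and their powers\<close>

lemma m_isometry_norm_sum:
  assumes "m_isometry m T"
  shows "(\<Sum>k=0..m. (-1) ^ k * real (m choose k) * (norm ((T ^^ k) x))\<^sup>2) = 0"
proof -
  have T: "bounded_clinear T"
    using assms by (simp add: m_isometry_def)
  have "complex_of_real (\<Sum>k=0..m. (-1) ^ k * real (m choose k) * (norm ((T ^^ k) x))\<^sup>2)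
      = (\<Sum>k=0..m. (-1) ^ k * of_nat (m choose k) * cinner ((T ^^ k) x) ((T ^^ k) x))"
    by (simp add: cinner_self)
  \<comment> \<open>The adjoint relation moves the power of \<open>T\<close> out of the left
    argument into the right one. Conjugate symmetry, used before and after, brings the adjoint
    powers to the left, where the sum can be collected.\<close>
  also have "\<dots> = (\<Sum>k=0..m. (-1) ^ k * of_nat (m choose k)
      * cinner ((cadjoint T ^^ k) ((T ^^ k) x)) x)"
    by (intro sum.cong refl arg_cong2 [where f = "(*)"])
      (metis T cinner_commute cinner_funpow_cadjoint)
  also have "\<dots> = cinner (\<Sum>k=0..m. ((-1) ^ k * of_nat (m choose k)) *\<^sub>C
      (cadjoint T ^^ k) ((T ^^ k) x)) x"
    by (simp add: cinner_sum_left cinner_scaleC_left)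
  also have "\<dots> = 0"
    using assms by (simp add: m_isometry_def)
  finally show ?thesis
    by (simp only: of_real_eq_0_iff)
qed

lemma m_isometry_bounded_below:
  assumes "m_isometry m T" and "m \<ge> 1"
  obtains c where "c > 0" and "\<And>x. norm x \<le> c * norm (T x)"
proof -
  obtain K where K: "\<And>x. norm (T x) \<le> norm x * K"
    using assms by (auto simp: m_isometry_def bounded_clinear_def)
  \<comment> \<open>On the zero space \<open>K\<close> may be negative; a nonnegative constant is
    needed to iterate the bound.\<close>
  define L where "L = max 0 K"
  have L: "norm (T x) \<le> L * norm x" for x
    using K [of x] mult_left_mono [of K L "norm x"] by (simp add: L_def mult.commute)
  have pow: "norm ((T ^^ k) y) \<le> L ^ k * norm y" for k y
  proof (induction k)
    case (Suc k)
    show ?case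
      using L [of "(T ^^ k) y"] mult_left_mono [OF Suc, of L] by (simp add: L_def mult.assoc)
  qed simp
  \<comment> \<open>For \<open>k \<ge> 1\<close> one application of \<open>T\<close> is kept and
    only the other \<open>k - 1\<close> are estimated, so each such term is at most a constant times
    the square of \<open>norm (T x)\<close>. \<open>C\<close> collects these constants.\<close>
  define C where "C = (\<Sum>k=1..m. real (m choose k) * (L ^ (k - 1))\<^sup>2)"
  have "(norm x)\<^sup>2 \<le> C * (norm (T x))\<^sup>2" for x
  proof -
    define g where "g k = (-1) ^ k * real (m choose k) * (norm ((T ^^ k) x))\<^sup>2" for k
    have "(norm x)\<^sup>2 + (\<Sum>k=1..m. g k) = 0"
      using m_isometry_norm_sum [OF assms(1), of x]
      by (simp add: sum.atLeast_Suc_atMost g_def)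
    then have "(norm x)\<^sup>2 = (\<Sum>k=1..m. - g k)"
      by (simp add: sum_negf)
    also have "\<dots> \<le> (\<Sum>k=1..m. real (m choose k) * (L ^ (k - 1))\<^sup>2 * (norm (T x))\<^sup>2)"
    proof (rule sum_mono)
      fix k
      assume "k \<in> {1..m}"
      then have "(T ^^ k) x = (T ^^ (k - 1)) (T x)"
        by (cases k) (simp_all add: funpow_swap1)
      then have "(norm ((T ^^ k) x))\<^sup>2 \<le> (L ^ (k - 1) * norm (T x))\<^sup>2"
        using pow [of "k - 1" "T x"] by (simp add: power_mono)
      then have "real (m choose k) * (norm ((T ^^ k) x))\<^sup>2
          \<le> real (m choose k) * (L ^ (k - 1) * norm (T x))\<^sup>2"
        by (intro mult_left_mono) simp_all
      \<comment> \<open>Equality for odd \<open>k\<close>; for even \<open>k\<close> the left side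
        is at most zero.\<close>
      moreover have "- g k \<le> real (m choose k) * (norm ((T ^^ k) x))\<^sup>2"
        by (cases "even k") (simp_all add: g_def)
      ultimately show "- g k \<le> real (m choose k) * (L ^ (k - 1))\<^sup>2 * (norm (T x))\<^sup>2"
        by (simp add: power_mult_distrib mult.assoc)
    qed
    finally show ?thesis
      by (simp add: C_def sum_distrib_right)
  qed
  \<comment> \<open>Replacing \<open>C\<close> by the square of \<open>C + 1\<close> avoids a square
    root and makes the resulting constant positive.\<close>
  moreover have "C \<le> (C + 1)\<^sup>2"
  proof -
    have "0 \<le> C"
      unfolding C_def by (intro sum_nonneg) simp
    then show ?thesis
      by (simp add: power2_sum)
  qed
  ultimately have "(norm x)\<^sup>2 \<le> ((C + 1) * norm (T x))\<^sup>2" for x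
    using mult_right_mono [of C "(C + 1)\<^sup>2" "(norm (T x))\<^sup>2"] order_trans
    by (fastforce simp: power_mult_distrib)
  moreover have "C + 1 > 0"
    unfolding C_def by (intro add_nonneg_pos sum_nonneg) simp_all
  ultimately have "norm x \<le> (C + 1) * norm (T x)" for x
    by (meson abs_ge_zero less_imp_le mult_nonneg_nonneg norm_ge_zero power2_le_imp_le)
  then show ?thesis
    using \<open>C + 1 > 0\<close> that by blast
qed

lemma funpow_bounded_below:
  fixes T :: "'a::real_normed_vector \<Rightarrow> 'a"
  assumes "\<And>x. norm x \<le> c * norm (T x)" and "c > 0"
  shows "norm x \<le> c ^ k * norm ((T ^^ k) x)"
proof (induction k)
  case (Suc k)
  have "c ^ k * norm ((T ^^ k) x) \<le> c ^ k * (c * norm ((T ^^ Suc k) x))"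
    using assms by (intro mult_left_mono) simp_all
  with Suc show ?case
    by (simp add: algebra_simps)
qed simp

section \<open>Orthonormal sets and finite dimension\<close>

definition corthonormal :: "'a::complex_inner set \<Rightarrow> bool"
  where "corthonormal B \<longleftrightarrow> (\<forall>x\<in>B. norm x = 1) \<and> (\<forall>x\<in>B. \<forall>y\<in>B. x \<noteq> y \<longrightarrow> cinner x y = 0)"

text \<open>By Pythagoras the distance is the square root of 2; the bound 1 is enough for the
  separation argument and free of roots.\<close>

lemma corthonormal_dist:
  assumes "corthonormal B" "x \<in> B" "y \<in> B" "x \<noteq> y"
  shows "1 < norm (x - y)"
proof -
  have "(norm (x - y))\<^sup>2 = 2"
    using assms norm_add_square [of x "- y"] cinner_diff_right [of x 0 y]
    by (simp add: corthonormal_def)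
  then show ?thesis
    by (metis norm_ge_zero one_less_numeral_iff one_power2 power_less_imp_less_base semiring_norm(76))
qed

text \<open>A pigeonhole argument. The image of the unit ball is covered by finitely many balls of
  radius \<open>1 / (2 * c)\<close>. If the images of two vectors lie in the same one, they are less
  than \<open>1 / c\<close> apart, and the lower bound puts the vectors less than 1 apart. Hence an
  orthonormal set injects into the set \<open>F\<close> of centres, which is chosen before
  \<open>B\<close>.\<close>

lemma compact_bounded_below_card_bound:
  fixes S :: "'a::complex_inner \<Rightarrow> 'a"
  assumes S: "compact_operator S" and below: "\<And>x. norm x \<le> c * norm (S x)" and "c > 0"
  obtains n where "\<And>B :: 'a set. finite B \<Longrightarrow> corthonormal B \<Longrightarrow> card B \<le> n"
proof -
  have "compact (closure (S ` cball 0 1))"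
    using S by (simp add: compact_operator_def)
  then obtain F where F: "finite F" "closure (S ` cball 0 1) \<subseteq> (\<Union>x\<in>F. ball x (1 / (2 * c)))"
    using \<open>c > 0\<close> unfolding compact_eq_totally_bounded
    by (meson divide_pos_pos mult_pos_pos zero_less_numeral zero_less_one)
  have "card B \<le> card F" if B: "corthonormal B" for B :: "'a set"
  proof -
    have "\<exists>y\<in>F. S x \<in> ball y (1 / (2 * c))" if "x \<in> B" for x
    proof -
      have "x \<in> cball 0 1"
        using B that by (simp add: corthonormal_def)
      then have "S x \<in> closure (S ` cball 0 1)"
        by (intro subsetD [OF closure_subset] imageI)
      then show ?thesis
        using F by blast
    qed
    then obtain h where h: "\<And>x. x \<in> B \<Longrightarrow> h x \<in> F \<and> S x \<in> ball (h x) (1 / (2 * c))"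
      by metis
    have "inj_on h B"
    proof (rule inj_onI, rule ccontr)
      fix x y
      assume xy: "x \<in> B" "y \<in> B" "h x = h y" "x \<noteq> y"
      have "dist (S x) (S y) < 1 / (2 * c) + 1 / (2 * c)"
        using h [OF xy(1)] h [OF xy(2)] xy(3) dist_triangle_less_add [of "S x" "h x"]
        by (metis dist_commute mem_ball)
      then have "c * norm (S (x - y)) < 1"
        using \<open>c > 0\<close> S
        by (simp add: dist_norm compact_operator_def bounded_clinear_diff field_simps)
      then show False
        using below [of "x - y"] corthonormal_dist [OF B xy(1,2,4)] by linarith
    qed
    then show ?thesis
      using h F(1) by (intro card_inj_on_le [of h]) auto
  qed
  then show ?thesis
    using that by blast
qed

text \<open>Subtracting from \<open>x\<close> its orthogonal projection \<open>p\<close> leaves a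
  remainder \<open>r\<close> orthogonal to \<open>B\<close>. If \<open>r\<close> were nonzero, its
  normalisation could be adjoined to \<open>B\<close>; by maximality it would already lie in
  \<open>B\<close> and so be orthogonal to itself.\<close>

lemma maximal_corthonormal_span:
  fixes B :: "'a::complex_inner set"
  assumes "finite B" "corthonormal B"
    and max: "\<And>y. corthonormal (insert y B) \<Longrightarrow> y \<in> B"
  shows "complex_vector.span B = UNIV"
proof -
  have "x \<in> complex_vector.span B" for x
  proof -
    define p where "p = (\<Sum>b\<in>B. cinner x b *\<^sub>C b)"
    have p: "p \<in> complex_vector.span B"
      unfolding p_def
      by (intro complex_vector.span_sum complex_vector.span_scale complex_vector.span_base)
    define r where "r = x - p"
    have orth: "cinner r b = 0" if "b \<in> B" for b
    proof -
      have "cinner p b = (\<Sum>a\<in>B. cinner x a * cinner a b)"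
        by (simp add: p_def cinner_sum_left cinner_scaleC_left)
      also have "\<dots> = (\<Sum>a\<in>B. if a = b then cinner x b else 0)"
        using assms(2) that by (intro sum.cong) (auto simp: corthonormal_def cinner_self)
      also have "\<dots> = cinner x b"
        using assms(1) that by simp
      finally show ?thesis
        by (simp add: r_def cinner_diff_left)
    qed
    have "r = 0"
    proof (rule ccontr)
      assume "r \<noteq> 0"
      define y where "y = complex_of_real (1 / norm r) *\<^sub>C r"
      have "norm y = 1"
        using \<open>r \<noteq> 0\<close> by (simp add: y_def scaleC_of_real del: of_real_divide)
      have y_orth: "cinner y b = 0" "cinner b y = 0" if "b \<in> B" for b
        using orth [OF that] cinner_commute [of b r]
        by (simp_all add: y_def cinner_scaleC_left cinner_scaleC_right)
      then have "corthonormal (insert y B)"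
        using assms(2) \<open>norm y = 1\<close> by (auto simp: corthonormal_def)
      then have "cinner y y = 0"
        using max y_orth by blast
      then show False
        using \<open>norm y = 1\<close> by (simp add: cinner_self)
    qed
    then show ?thesis
      using p by (simp add: r_def)
  qed
  then show ?thesis
    by blast
qed

lemma compact_bounded_below_finite_dimensional:
  fixes S :: "'a::complex_inner \<Rightarrow> 'a"
  assumes "compact_operator S" and "\<And>x. norm x \<le> c * norm (S x)" and "c > 0"
  obtains B :: "'a set"
  where "finite_dimensional_vector_space (scaleC :: complex \<Rightarrow> 'a \<Rightarrow> 'a) B"
proof -
  obtain n where n: "\<And>B :: 'a set. finite B \<Longrightarrow> corthonormal B \<Longrightarrow> card B \<le> n"
    using compact_bounded_below_card_bound assms by blast
  let ?P = "\<lambda>k. \<exists>B :: 'a set. finite B \<and> corthonormal B \<and> card B = k"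
  have "?P 0"
    by (rule exI [of _ "{}"]) (simp add: corthonormal_def)
  \<comment> \<open>The uniform bound \<open>n\<close> makes a largest cardinality exist. An
    orthonormal set attaining it cannot be enlarged.\<close>
  then have "?P (Greatest ?P)"
    by (rule GreatestI_nat [where b = n]) (use n in blast)
  then obtain E :: "'a set" where E: "finite E" "corthonormal E" "card E = Greatest ?P"
    by blast
  have "y \<in> E" if "corthonormal (insert y E)" for y
  proof (rule ccontr)
    assume "y \<notin> E"
    then have "?P (Suc (card E))"
      using E(1) that by (intro exI [of _ "insert y E"]) simp
    then have "Suc (card E) \<le> Greatest ?P"
      by (rule Greatest_le_nat [where b = n]) (use n in blast)
    then show False
      using E(3) by simp
  qed
  then have span: "complex_vector.span E = UNIV"
    using E maximal_corthonormal_span by blast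
  \<comment> \<open>Thinning out the spanning set \<open>E\<close> to a basis replaces a proof that
    orthonormal vectors are independent.\<close>
  obtain B where B: "B \<subseteq> E" "complex_vector.independent B" "E \<subseteq> complex_vector.span B"
    using complex_vector.maximal_independent_subset by blast
  have "finite_dimensional_vector_space (scaleC :: complex \<Rightarrow> 'a \<Rightarrow> 'a) B"
  proof unfold_locales
    show "finite B"
      using B(1) E(1) finite_subset by blast
    show "complex_vector.independent B"
      by fact
    show "complex_vector.span B = UNIV"
      using complex_vector.span_minimal [OF B(3)] span by auto
  qed
  then show ?thesis
    by (rule that)
qed

section \<open>Polynomials in an operator, and algebraicity in finite dimension\<close>

lemma poly_operator_eq_sum:
  assumes "degree p \<le> n"
  shows "poly_operator p T x = (\<Sum>i\<le>n. coeff p i *\<^sub>C (T ^^ i) x)"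
  unfolding poly_operator_def using assms
  by (intro sum.mono_neutral_left) (auto simp: coeff_eq_0 not_le)

lemma poly_operator_0 [simp]: "poly_operator 0 T x = 0"
  by (simp add: poly_operator_def)

text \<open>This Horner recursion drives the later inductions over the coefficients of a
  polynomial.\<close>

lemma poly_operator_pCons:
  assumes T: "bounded_clinear T"
  shows "poly_operator (pCons a p) T x = a *\<^sub>C x + T (poly_operator p T x)"
proof -
  have T_sum: "T (\<Sum>i\<in>A. coeff p i *\<^sub>C (T ^^ i) x) = (\<Sum>i\<in>A. coeff p i *\<^sub>C (T ^^ Suc i) x)"
    if "finite A" for A
    using that
    by (induction A rule: finite_induct)
      (simp_all add: bounded_clinear_zero [OF T] bounded_clinear_add [OF T]
        bounded_clinear_scaleC [OF T])
  \<comment> \<open>The range ends at \<open>Suc (degree p)\<close> even where the true degree is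
    smaller, as for \<open>p = 0\<close>; this spares a case distinction.\<close>
  have "poly_operator (pCons a p) T x = (\<Sum>i\<le>Suc (degree p). coeff (pCons a p) i *\<^sub>C (T ^^ i) x)"
    by (rule poly_operator_eq_sum) (simp add: degree_pCons_le)
  also have "\<dots> = a *\<^sub>C x + (\<Sum>i\<le>degree p. coeff p i *\<^sub>C (T ^^ Suc i) x)"
    by (simp add: sum.atMost_Suc_shift del: sum.atMost_Suc)
  finally show ?thesis
    by (simp add: T_sum poly_operator_def del: funpow.simps)
qed

lemma poly_operator_add:
  "poly_operator (p + q) T x = poly_operator p T x + poly_operator q T x"
proof -
  \<comment> \<open>The three degrees may differ, by cancellation too, so all sums are extended to a
    common range by zero coefficients.\<close>
  let ?n = "max (degree p) (degree q)"
  have "poly_operator (p + q) T x = (\<Sum>i\<le>?n. coeff (p + q) i *\<^sub>C (T ^^ i) x)"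
    by (rule poly_operator_eq_sum) (simp add: degree_add_le_max)
  then show ?thesis
    by (simp add: poly_operator_eq_sum [of p ?n] poly_operator_eq_sum [of q ?n]
        scaleC_add_left sum.distrib)
qed

lemma poly_operator_smult: "poly_operator (smult a p) T x = a *\<^sub>C poly_operator p T x"
  by (simp add: poly_operator_eq_sum [of "smult a p" "degree p"] degree_smult_le
      poly_operator_def complex_vector.scale_sum_right)

lemma poly_operator_mult:
  assumes "bounded_clinear T"
  shows "poly_operator (p * q) T x = poly_operator p T (poly_operator q T x)"
  by (induction p)
    (simp_all add: poly_operator_add poly_operator_smult poly_operator_pCons [OF assms])

lemma poly_operator_linear:
  assumes T: "bounded_clinear T"
  shows "poly_operator p T (x + y) = poly_operator p T x + poly_operator p T y"
    and "poly_operator p T (a *\<^sub>C x) = a *\<^sub>C poly_operator p T x"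
    and "poly_operator p T 0 = 0"
  by (induction p)
    (simp_all add: poly_operator_pCons [OF T] bounded_clinear_add [OF T] bounded_clinear_zero [OF T]
      bounded_clinear_scaleC [OF T] scaleC_add_right scaleC_scaleC mult.commute)

text \<open>The orbit vectors from \<open>x\<close> up to \<open>(T ^^ n) x\<close> are one more
  than the dimension allows to be independent. The coefficients of a nontrivial relation among them
  form the polynomial.\<close>

lemma local_annihilator:
  fixes T :: "'a::complex_inner \<Rightarrow> 'a"
  assumes "finite_dimensional_vector_space (scaleC :: complex \<Rightarrow> 'a \<Rightarrow> 'a) B"
  shows "\<exists>p. p \<noteq> 0 \<and> poly_operator p T x = 0"
proof -
  interpret finite_dimensional_vector_space "scaleC :: complex \<Rightarrow> 'a \<Rightarrow> 'a" B
    by fact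
  define f where "f i = (T ^^ i) x" for i
  define n where "n = card B"
  have "\<exists>u. (\<exists>i\<le>n. u i \<noteq> 0) \<and> (\<Sum>i\<le>n. u i *\<^sub>C f i) = 0"
  \<comment> \<open>Dependence is a property of sets, in which repeated orbit vectors would
    collapse. A repetition therefore gets its own relation, with coefficients 1 and -1 at the two
    indices.\<close>
  proof (cases "inj_on f {..n}")
    case True
    then have "card (f ` {..n}) > card B"
      by (simp add: card_image n_def)
    then have "complex_vector.dependent (f ` {..n})"
      using complex_vector.independent_span_bound [OF finite_Basis, of "f ` {..n}"] by (auto simp: span_Basis)
    then obtain u where u: "\<exists>v\<in>f ` {..n}. u v \<noteq> 0" "(\<Sum>v\<in>f ` {..n}. u v *\<^sub>C v) = 0"
      using complex_vector.dependent_finite [of "f ` {..n}"] by auto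
    from u(2) have "(\<Sum>i\<le>n. u (f i) *\<^sub>C f i) = 0"
      by (simp add: sum.reindex [OF True])
    then show ?thesis
      using u(1) by (intro exI [of _ "\<lambda>i. u (f i)"]) auto
  next
    case False
    then obtain i j where ij: "i \<le> n" "j \<le> n" "i \<noteq> j" "f i = f j"
      by (auto simp: inj_on_def)
    define u :: "nat \<Rightarrow> complex" where "u k = (if k = i then 1 else 0) + (if k = j then -1 else 0)" for k
    have "(\<Sum>k\<le>n. u k *\<^sub>C f k)
        = (\<Sum>k\<le>n. (if k = i then f i else 0) + (if k = j then - f j else 0))"
      using ij(3) by (intro sum.cong) (auto simp: u_def)
    also have "\<dots> = 0"
      using ij by (simp add: sum.distrib)
    finally show ?thesis
      using ij by (intro exI [of _ u]) (auto simp: u_def)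
  qed
  then obtain u where u: "\<exists>i\<le>n. u i \<noteq> 0" "(\<Sum>i\<le>n. u i *\<^sub>C f i) = 0"
    by blast
  define p where "p = (\<Sum>i\<le>n. monom (u i) i)"
  have coeff: "coeff p i = (if i \<le> n then u i else 0)" for i
    by (simp add: p_def coeff_sum)
  have "degree p \<le> n"
    by (rule degree_le) (simp add: coeff)
  then have "poly_operator p T x = 0"
    using u(2) by (simp add: poly_operator_eq_sum coeff f_def)
  moreover have "p \<noteq> 0"
    using u(1) coeff by (metis coeff_0)
  ultimately show ?thesis
    by blast
qed

text \<open>The product of annihilators of the basis vectors kills the whole basis, hence by
  linearity its span. It is nonzero because complex polynomials have no zero divisors.\<close>

lemma finite_dimensional_algebraic:
  fixes T :: "'a::complex_inner \<Rightarrow> 'a"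
  assumes fd: "finite_dimensional_vector_space (scaleC :: complex \<Rightarrow> 'a \<Rightarrow> 'a) B"
    and T: "bounded_clinear T"
  shows "algebraic_operator T"
proof -
  interpret finite_dimensional_vector_space "scaleC :: complex \<Rightarrow> 'a \<Rightarrow> 'a" B
    by fact
  obtain q where q: "\<And>b. q b \<noteq> 0" "\<And>b. poly_operator (q b) T b = 0"
    using local_annihilator [OF fd] by metis
  define p where "p = prod q B"
  have "p \<noteq> 0"
    using q(1) finite_Basis by (simp add: p_def)
  have kill: "poly_operator p T b = 0" if "b \<in> B" for b
  proof -
    \<comment> \<open>By commutativity the factor \<open>q b\<close> can be written last, so it is
      the first to act on \<open>b\<close>.\<close>
    have "p = prod q (B - {b}) * q b"
      using that finite_Basis by (simp add: p_def prod.remove mult.commute)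
    then show ?thesis
      by (simp add: poly_operator_mult [OF T] q(2) poly_operator_linear(3) [OF T])
  qed
  have "poly_operator p T x = 0" for x
  proof -
    have "x \<in> complex_vector.span B"
      by (simp add: span_Basis)
    then show ?thesis
      by (induction rule: complex_vector.span_induct_alt)
        (simp_all add: poly_operator_linear [OF T] kill)
  qed
  then show ?thesis
    unfolding algebraic_operator_def using \<open>p \<noteq> 0\<close> by blast
qed

theorem proposition6p6:
  fixes T :: "'a::chilbert_space \<Rightarrow> 'a" and m l :: nat
  assumes "m \<ge> 1"
    and "m_isometry m T"
    and "l \<ge> 1"
    and "compact_operator (T ^^ l)"
  shows "(\<exists>B :: 'a set. finite_dimensional_vector_space (scaleC :: complex \<Rightarrow> 'a \<Rightarrow> 'a) B)
    \<and> algebraic_operator T \<and> m_isometry m T"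
proof -
  obtain c where c: "c > 0" "\<And>x. norm x \<le> c * norm (T x)"
    using m_isometry_bounded_below assms by blast
  \<comment> \<open>The lower bound is iterated \<open>l\<close> times so that it applies to the
    compact operator \<open>T ^^ l\<close>.\<close>
  obtain B where B: "finite_dimensional_vector_space (scaleC :: complex \<Rightarrow> 'a \<Rightarrow> 'a) B"
    using compact_bounded_below_finite_dimensional [OF assms(4), of "c ^ l"]
      funpow_bounded_below [of c T, OF c(2) c(1)] c(1) by (metis zero_less_power)
  moreover have "algebraic_operator T"
    using finite_dimensional_algebraic [OF B] assms(2) by (simp add: m_isometry_def)
  ultimately show ?thesis
    using assms(2) by blast
qed

end
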